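(* Let $\bm A\in\mathbb R^{N\times N}$, $\bm B\in\mathbb R^N$ be defined, with indices $n,k$ starting at $0$, by $$\bm A_{nk}=\begin{cases}-2&n=k=0\\-2\sqrt2&n=0,\ k\text{ odd}\\-2\sqrt2&k=0,\ n\text{ odd}\\-4&n,k\text{ odd}\\ 2\pi\frac{k+1}{2}&n-k=1,\ k\text{ odd}\\-2\pi\frac{n+1}{2}&k-n=1,\ n\text{ odd}\\0&\text{otherwise}\end{cases}\qquad \bm B_n=\begin{cases}2&n=0\\2\sqrt2&n\text{ odd}\\0&\text{otherwise.}\end{cases}$$ As $N\to\infty$, the SSM $(\bm A,\bm B)$ is a TOSSM with measure $\omega(t)=\mathbb I(t)$, and $\{p_n\}$ are the truncated Fourier basis functions orthonormal on $[0,1]$, ordered in the form $\{p_n\}_{n\ge0}=(1,c_1(t),s_1(t),c_2(t),s_2(t),\dots)$, where $s_m(t)=\sqrt2\sin(2\pi mt)$ and $c_m(t)=\sqrt2\cos(2\pi mt)$ for $m$ up to $N/2$.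
   Context: $\mathbb I$ is the indicator function of $[0,1]$. A time-invariant SSM $(\bm A,\bm B)$ is the system $x'(t)=\bm Ax(t)+\bm Bu(t)$ with scalar input $u$ and state $x(t)\in\mathbb R^N$; its basis kernels are $K_n(t)=\bm e_n^\top e^{t\bm A}\bm B$ ($\bm e_n$ the $n$-th standard basis vector), so that $x_n(t)=\int_{-\infty}^tK_n(t-s)u(s)\,ds$. It is a time-invariant orthogonal SSM (TOSSM) with basis $p_n(t)$ and measure $\omega(t)\ge0$ if $K_n(t)=p_n(t)\omega(t)$ and $\int_{-\infty}^tp_n(t-s)p_m(t-s)\omega(t-s)\,ds=\delta_{nm}$.
   Formalization: N is restricted to odd values, so each cosine c_m is paired with s_m; for even N the claim fails (K_0 tends to e^{-2t} on (0,1), not 1). The limit N→∞ is taken as L² convergence of each kernel K_n on t ≥ 0. *)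

theory Defs
  imports "HOL-Analysis.Analysis" "Jordan_Normal_Form.Matrix"
begin

(* Square matrices only: the power series of exp, taken entrywise. *)
definition mat_exp :: "real mat \<Rightarrow> real mat" where
  "mat_exp A = mat (dim_row A) (dim_row A)
     (\<lambda>(i, j). \<Sum>k. (A ^\<^sub>m k) $$ (i, j) / fact k)"

definition is_ssm :: "real mat \<Rightarrow> real Matrix.vec \<Rightarrow> bool" where
  "is_ssm A B \<longleftrightarrow> square_mat A \<and> dim_vec B = dim_row A"

(* K_n(t) = e_n^T exp(t A) B, the impulse response of the n-th coordinate of x' = A x + B u. *)
definition ssm_kernel :: "real mat \<Rightarrow> real Matrix.vec \<Rightarrow> nat \<Rightarrow> real \<Rightarrow> real" where
  "ssm_kernel A B n t =
     scalar_prod (unit_vec (dim_row A) n) (mat_exp (t \<cdot>\<^sub>m A) *\<^sub>v B)"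

(* Kernels indexed by I, compared with p_n * omega for t >= 0 only: the state
   x_n(t) is the integral of K_n(t - s) u(s) over s <= t, so K_n is only ever
   evaluated at nonnegative arguments. *)
definition tossm_kernels ::
  "nat set \<Rightarrow> (nat \<Rightarrow> real \<Rightarrow> real) \<Rightarrow> (nat \<Rightarrow> real \<Rightarrow> real) \<Rightarrow> (real \<Rightarrow> real) \<Rightarrow> bool" where
  "tossm_kernels I K p \<omega> \<longleftrightarrow>
     (\<forall>t. \<omega> t \<ge> 0) \<and>
     (\<forall>n\<in>I. \<forall>t\<ge>0. K n t = p n t * \<omega> t) \<and>
     (\<forall>n\<in>I. \<forall>m\<in>I. \<forall>t.
        set_integrable lborel {..t} (\<lambda>s. p n (t - s) * p m (t - s) * \<omega> (t - s)) \<and>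
        (LBINT s:{..t}. p n (t - s) * p m (t - s) * \<omega> (t - s)) = (if n = m then 1 else 0))"

(* A single system: the N = dim_row A basis kernels satisfy the conditions exactly. *)
definition tossm ::
  "real mat \<Rightarrow> real Matrix.vec \<Rightarrow> (nat \<Rightarrow> real \<Rightarrow> real) \<Rightarrow> (real \<Rightarrow> real) \<Rightarrow> bool" where
  "tossm A B p \<omega> \<longleftrightarrow> is_ssm A B \<and> tossm_kernels {..<dim_row A} (ssm_kernel A B) p \<omega>"

(* A family of systems of growing dimension is a TOSSM in the limit if each basis
   kernel converges and the limit kernels satisfy the conditions exactly.  Convergence
   is in L^2 of the half-line [0, infinity).  Convergence at every single point would be
   too much to ask for: K_n(0) = B_n for every dimension, whereas for the Fourier
   systems below B_n = 2 p_n(0). *)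
definition tossm_in_limit ::
  "(nat \<Rightarrow> real mat) \<Rightarrow> (nat \<Rightarrow> real Matrix.vec) \<Rightarrow>
     (nat \<Rightarrow> real \<Rightarrow> real) \<Rightarrow> (real \<Rightarrow> real) \<Rightarrow> bool" where
  "tossm_in_limit A B p \<omega> \<longleftrightarrow>
     (\<forall>M. is_ssm (A M) (B M)) \<and>
     filterlim (\<lambda>M. dim_row (A M)) at_top sequentially \<and>
     (\<exists>K. (\<forall>n. ((\<lambda>M. \<integral>\<^sup>+ t \<in> {0..}.
                  ennreal ((ssm_kernel (A M) (B M) n t - K n t)\<^sup>2) \<partial>lborel)
                \<longlongrightarrow> 0) sequentially) \<and>
          tossm_kernels UNIV K p \<omega>)"

definition fourier_A :: "nat \<Rightarrow> real mat" where
  "fourier_A N = mat N N (\<lambda>(n, k).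
     if n = 0 \<and> k = 0 then - 2
     else if n = 0 \<and> odd k then - 2 * sqrt 2
     else if k = 0 \<and> odd n then - 2 * sqrt 2
     else if odd n \<and> odd k then - 4
     else if n = k + 1 \<and> odd k then 2 * pi * ((real k + 1) / 2)
     else if k = n + 1 \<and> odd n then - 2 * pi * ((real n + 1) / 2)
     else 0)"

definition fourier_B :: "nat \<Rightarrow> real Matrix.vec" where
  "fourier_B N = Matrix.vec N (\<lambda>n.
     if n = 0 then 2 else if odd n then 2 * sqrt 2 else 0)"

definition fourier_c :: "nat \<Rightarrow> real \<Rightarrow> real" where
  "fourier_c m t = sqrt 2 * cos (2 * pi * real m * t)"

definition fourier_s :: "nat \<Rightarrow> real \<Rightarrow> real" where
  "fourier_s m t = sqrt 2 * sin (2 * pi * real m * t)"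

(* The ordering 1, c_1, s_1, c_2, s_2, ... *)
definition fourier_basis :: "nat \<Rightarrow> real \<Rightarrow> real" where
  "fourier_basis n =
     (if n = 0 then (\<lambda>t. 1)
      else if odd n then fourier_c ((n + 1) div 2)
      else fourier_s (n div 2))"

end

(* Write A = R - 2 v v^T with R skew-symmetric, and B = 2 v.  Row n of exp(t A), called w, solves
   w' = - R w - K v with K = 2 v . w the kernel K_n, so |w|^2 decreases at rate K^2.  In the
   limit this is transport on [0,1] with absorption at 0, whose solution is p_n(. + t) 1_[0,1-t].
   In every dimension 2 M + 1 the vector q of the first Fourier coefficients of that solution
   satisfies q' = - R q - p_n v with q(0) = w(0) and q(1) = 0.  The energy identity for w - q, followed by
   that for w on [1, infinity), bounds the L^2 error of the kernel by that of v . q - p_n / 2,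
   where v . q is a partial Fourier sum evaluated at the jump.  Integrating by parts against the
   antiderivative of the Dirichlet kernel reduces this to the convergence in L^2 of the Fourier
   series of the sawtooth 1/2 - x, which is the Basel sum. *)
theory Submission
  imports Defs
begin

subsection \<open>The matrix exponential\<close>

lemma pow_smult_mat:
  fixes A :: "'a::comm_semiring_1 mat"
  assumes A: "A \<in> carrier_mat N N"
  shows "(t \<cdot>\<^sub>m A) ^\<^sub>m k = t ^ k \<cdot>\<^sub>m A ^\<^sub>m k"
proof (induction k)
  case 0
  show ?case by auto
next
  case (Suc k)
  have Ak: "A ^\<^sub>m k \<in> carrier_mat N N" using A by simp
  have "(t \<cdot>\<^sub>m A) ^\<^sub>m Suc k = (t ^ k \<cdot>\<^sub>m A ^\<^sub>m k) * (t \<cdot>\<^sub>m A)"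
    using Suc by simp
  also have "\<dots> = t ^ k \<cdot>\<^sub>m (A ^\<^sub>m k * (t \<cdot>\<^sub>m A))"
    using A Ak by (intro mult_smult_assoc_mat) auto
  also have "A ^\<^sub>m k * (t \<cdot>\<^sub>m A) = t \<cdot>\<^sub>m (A ^\<^sub>m k * A)"
    using A Ak by (intro mult_smult_distrib) auto
  finally show ?case by (auto simp: mult_ac)
qed

lemma pow_mat_Suc_index:
  fixes A :: "'a::semiring_1 mat"
  assumes A: "A \<in> carrier_mat N N" and "i < N" "j < N"
  shows "(A ^\<^sub>m Suc k) $$ (i, j) = (\<Sum>l<N. (A ^\<^sub>m k) $$ (i, l) * A $$ (l, j))"
proof -
  have "A ^\<^sub>m k \<in> carrier_mat N N" using A by simp
  then show ?thesis
    using assms by (simp add: scalar_prod_def atLeast0LessThan)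
qed

text \<open>One constant serves all powers and all entries, so the exponential series of
  \<open>c * \<bar>t\<bar>\<close> majorizes the series of every entry of
  \<open>mat_exp (t \<cdot>\<^sub>m A)\<close>.\<close>

lemma pow_mat_index_bound:
  fixes A :: "real mat"
  assumes A: "A \<in> carrier_mat N N"
  obtains c where "\<And>k i j. i < N \<Longrightarrow> j < N \<Longrightarrow> \<bar>(A ^\<^sub>m k) $$ (i, j)\<bar> \<le> c ^ k"
proof
  \<comment> \<open>The sum of all absolute entries dominates each absolute row sum of
    \<open>A\<close>, so a further factor \<open>A\<close> multiplies the absolute row sums of the
    power by at most \<open>c\<close>.\<close>
  define c where "c = (\<Sum>l<N. \<Sum>j<N. \<bar>A $$ (l, j)\<bar>)"
  have c0: "c \<ge> 0" unfolding c_def by (intro sum_nonneg) auto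
  have row: "(\<Sum>j<N. \<bar>(A ^\<^sub>m k) $$ (i, j)\<bar>) \<le> c ^ k" if i: "i < N" for i k
  proof (induction k)
    case 0
    have "(\<Sum>j<N. \<bar>(A ^\<^sub>m 0) $$ (i, j)\<bar>) = (\<Sum>j<N. if j = i then 1 else 0)"
      using A i by (intro sum.cong) auto
    then show ?case using i by simp
  next
    case (Suc k)
    have "(\<Sum>j<N. \<bar>(A ^\<^sub>m Suc k) $$ (i, j)\<bar>)
        \<le> (\<Sum>j<N. \<Sum>l<N. \<bar>(A ^\<^sub>m k) $$ (i, l)\<bar> * \<bar>A $$ (l, j)\<bar>)"
    proof (intro sum_mono)
      fix j assume "j \<in> {..<N}"
      then have "\<bar>(A ^\<^sub>m Suc k) $$ (i, j)\<bar> = \<bar>\<Sum>l<N. (A ^\<^sub>m k) $$ (i, l) * A $$ (l, j)\<bar>"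
        using pow_mat_Suc_index[OF A i] by simp
      also have "\<dots> \<le> (\<Sum>l<N. \<bar>(A ^\<^sub>m k) $$ (i, l) * A $$ (l, j)\<bar>)" by (rule sum_abs)
      finally show "\<bar>(A ^\<^sub>m Suc k) $$ (i, j)\<bar>
        \<le> (\<Sum>l<N. \<bar>(A ^\<^sub>m k) $$ (i, l)\<bar> * \<bar>A $$ (l, j)\<bar>)" by (simp only: abs_mult)
    qed
    also have "\<dots> = (\<Sum>l<N. \<bar>(A ^\<^sub>m k) $$ (i, l)\<bar> * (\<Sum>j<N. \<bar>A $$ (l, j)\<bar>))"
      by (subst sum.swap) (simp add: sum_distrib_left)
    also have "\<dots> \<le> (\<Sum>l<N. \<bar>(A ^\<^sub>m k) $$ (i, l)\<bar> * c)"
    proof (intro sum_mono mult_left_mono)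
      fix l assume "l \<in> {..<N}"
      then show "(\<Sum>j<N. \<bar>A $$ (l, j)\<bar>) \<le> c"
        unfolding c_def
        by (intro member_le_sum[of l "{..<N}" "\<lambda>l. \<Sum>j<N. \<bar>A $$ (l, j)\<bar>"]) (auto intro: sum_nonneg)
    qed auto
    also have "\<dots> \<le> c ^ k * c"
      using Suc c0 by (simp add: sum_distrib_right[symmetric] mult_right_mono)
    finally show ?case by (simp add: mult.commute)
  qed
  fix k i j assume "i < N" "j < N"
  then have "\<bar>(A ^\<^sub>m k) $$ (i, j)\<bar> \<le> (\<Sum>j<N. \<bar>(A ^\<^sub>m k) $$ (i, j)\<bar>)"
    by (intro member_le_sum[of j "{..<N}" "\<lambda>j. \<bar>(A ^\<^sub>m k) $$ (i, j)\<bar>"]) auto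
  with row[OF \<open>i < N\<close>] show "\<bar>(A ^\<^sub>m k) $$ (i, j)\<bar> \<le> c ^ k" by (rule order_trans[rotated])
qed

lemma summable_mat_exp:
  fixes A :: "real mat"
  assumes A: "A \<in> carrier_mat N N" and ij: "i < N" "j < N"
  shows "summable (\<lambda>k. (A ^\<^sub>m k) $$ (i, j) / fact k * t ^ k)"
proof -
  obtain c where c: "\<And>k. \<bar>(A ^\<^sub>m k) $$ (i, j)\<bar> \<le> c ^ k"
    using pow_mat_index_bound[OF A] ij by metis
  show ?thesis
  proof (rule summable_comparison_test')
    show "summable (\<lambda>k. inverse (fact k) * (c * \<bar>t\<bar>) ^ k)" by (rule summable_exp)
    show "norm ((A ^\<^sub>m k) $$ (i, j) / fact k * t ^ k) \<le> inverse (fact k) * (c * \<bar>t\<bar>) ^ k"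
      if "k \<ge> 0" for k
      using mult_right_mono[OF c[of k], of "\<bar>t\<bar> ^ k / fact k"]
      by (simp add: abs_mult power_mult_distrib power_abs divide_simps)
  qed
qed

lemma mat_exp_smult_index:
  assumes A: "A \<in> carrier_mat N N" and ij: "i < N" "j < N"
  shows "mat_exp (t \<cdot>\<^sub>m A) $$ (i, j) = (\<Sum>k. (A ^\<^sub>m k) $$ (i, j) / fact k * t ^ k)"
proof -
  have "((t \<cdot>\<^sub>m A) ^\<^sub>m k) $$ (i, j) = t ^ k * (A ^\<^sub>m k) $$ (i, j)" for k
    using A ij by (simp add: pow_smult_mat[OF A])
  then show ?thesis
    using A ij by (simp add: mat_exp_def mult_ac)
qed

lemma mat_exp_smult_0:
  assumes A: "A \<in> carrier_mat N N" and ij: "i < N" "j < N"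
  shows "mat_exp (0 \<cdot>\<^sub>m A) $$ (i, j) = (if i = j then 1 else 0)"
  unfolding mat_exp_smult_index[OF assms] powser_zero using assms by simp

text \<open>Termwise differentiation of an everywhere convergent power series. \<open>A\<close> is
  split off on the right so that the derivative of row \<open>i\<close> involves row
  \<open>i\<close> only, the row that kernel \<open>i\<close> reads.\<close>

lemma mat_exp_smult_has_derivative:
  assumes A: "A \<in> carrier_mat N N" and ij: "i < N" "j < N"
  shows "((\<lambda>t. mat_exp (t \<cdot>\<^sub>m A) $$ (i, j)) has_real_derivative
           (\<Sum>l<N. mat_exp (t \<cdot>\<^sub>m A) $$ (i, l) * A $$ (l, j))) (at t)"
proof -
  define c where "c l k = (A ^\<^sub>m k) $$ (i, l) / fact k" for l k
  have sm: "summable (\<lambda>k. c l k * t ^ k)" if "l < N" for l t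
    unfolding c_def by (rule summable_mat_exp[OF A ij(1) that])
  \<comment> \<open>The derived series cancels one factor of the factorial and exposes one more
    factor \<open>A\<close>.\<close>
  have diffs: "diffs (c j) k * t ^ k = (\<Sum>l<N. c l k * t ^ k * A $$ (l, j))" for k
  proof -
    have "diffs (c j) k = (A ^\<^sub>m Suc k) $$ (i, j) / fact k"
      unfolding diffs_def c_def by (simp add: divide_simps)
    also have "\<dots> = (\<Sum>l<N. (A ^\<^sub>m k) $$ (i, l) * A $$ (l, j)) / fact k"
      by (simp only: pow_mat_Suc_index[OF A ij])
    finally show ?thesis
      by (simp add: c_def sum_distrib_left sum_distrib_right sum_divide_distrib mult_ac)
  qed
  have "((\<lambda>t. \<Sum>k. c j k * t ^ k) has_real_derivative (\<Sum>k. diffs (c j) k * t ^ k)) (at t)"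
    by (rule termdiffs_strong_converges_everywhere) (rule sm[OF ij(2)])
  also have "(\<Sum>k. diffs (c j) k * t ^ k) = (\<Sum>l<N. (\<Sum>k. c l k * t ^ k) * A $$ (l, j))"
    unfolding diffs
    by (subst suminf_sum) (auto intro!: summable_mult2 sm suminf_mult2[symmetric] sum.cong)
  finally show ?thesis
    using A ij by (simp add: mat_exp_smult_index c_def)
qed

lemma ssm_kernel_eq:
  assumes "A \<in> carrier_mat N N" "dim_vec B = N" "n < N"
  shows "ssm_kernel A B n t = (\<Sum>j<N. mat_exp (t \<cdot>\<^sub>m A) $$ (n, j) * vec_index B j)"
proof -
  have E: "mat_exp (t \<cdot>\<^sub>m A) \<in> carrier_mat N N" using assms by (simp add: mat_exp_def)
  then show ?thesis
    using assms unfolding ssm_kernel_def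
    by (subst scalar_prod_left_unit) (auto simp: scalar_prod_def atLeast0LessThan)
qed

subsection \<open>Energy identities\<close>

text \<open>The quadratic form of a skew matrix vanishes, so only the forcing along \<open>v\<close>
  changes the energy. The set \<open>T\<close> admits two-sided derivatives on the whole line as
  well as one-sided ones at the ends of [0,1].\<close>

lemma skew_energy_has_derivative:
  fixes d :: "'i \<Rightarrow> real \<Rightarrow> real"
  assumes skew: "\<And>i j. i \<in> I \<Longrightarrow> j \<in> I \<Longrightarrow> R i j = - R j i"
    and d: "\<And>j. j \<in> I \<Longrightarrow> (d j has_real_derivative - (\<Sum>i\<in>I. R j i * d i t) - f * v j) (at t within T)"
  shows "((\<lambda>t. \<Sum>j\<in>I. (d j t)\<^sup>2) has_real_derivative - 2 * f * (\<Sum>j\<in>I. v j * d j t)) (at t within T)"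
proof -
  \<comment> \<open>The quadratic form of \<open>R\<close>; exchanging the sums and using skewness
    gives \<open>Z = - Z\<close>.\<close>
  define Z where "Z = (\<Sum>j\<in>I. \<Sum>i\<in>I. R j i * d i t * d j t)"
  have "Z = (\<Sum>i\<in>I. \<Sum>j\<in>I. R j i * d i t * d j t)" unfolding Z_def by (rule sum.swap)
  also have "\<dots> = (\<Sum>i\<in>I. \<Sum>j\<in>I. - (R i j * d j t * d i t))"
  proof (intro sum.cong refl)
    fix i j assume "i \<in> I" "j \<in> I"
    then show "R j i * d i t * d j t = - (R i j * d j t * d i t)"
      using skew[of j i] by simp
  qed
  also have "\<dots> = - Z" by (simp add: Z_def sum_negf)
  finally have Z0: "Z = 0" by simp
  have "((\<lambda>t. \<Sum>j\<in>I. (d j t)\<^sup>2) has_real_derivative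
      (\<Sum>j\<in>I. 2 * d j t * (- (\<Sum>i\<in>I. R j i * d i t) - f * v j))) (at t within T)"
    by (intro DERIV_sum) (auto intro!: derivative_eq_intros d)
  also have "(\<Sum>j\<in>I. 2 * d j t * (- (\<Sum>i\<in>I. R j i * d i t) - f * v j))
      = - 2 * Z - 2 * f * (\<Sum>j\<in>I. v j * d j t)"
    unfolding Z_def sum_distrib_left sum_subtractf[symmetric]
    by (intro sum.cong refl) (simp add: algebra_simps sum_distrib_left sum_negf)
  finally show ?thesis using Z0 by simp
qed

text \<open>The integral over \<open>{a..a + real n}\<close> is \<open>F a - F (a + real n)\<close>,
  at most \<open>F a\<close> by nonnegativity of \<open>F\<close>; monotone convergence extends the
  bound to the half-line.\<close>

lemma nn_integral_tail_le:
  fixes f F :: "real \<Rightarrow> real"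
  assumes F: "\<And>t. (F has_real_derivative - f t) (at t)"
    and f: "\<And>t. f t \<ge> 0" "f \<in> borel_measurable borel"
    and F0: "\<And>t. F t \<ge> 0"
  shows "(\<integral>\<^sup>+t\<in>{a..}. ennreal (f t) \<partial>lborel) \<le> ennreal (F a)"
proof -
  have "ennreal (f t) * indicator {a..} t = (SUP n. ennreal (f t) * indicator {a..a + real n} t)" for t
  proof (rule antisym)
    obtain n where n: "t - a \<le> real n" using real_arch_simple by blast
    have "ennreal (f t) * indicator {a..} t \<le> ennreal (f t) * indicator {a..a + real n} t"
      using n by (auto simp: indicator_def)
    also have "\<dots> \<le> (SUP n. ennreal (f t) * indicator {a..a + real n} t)"
      by (rule SUP_upper) auto
    finally show "ennreal (f t) * indicator {a..} t
      \<le> (SUP n. ennreal (f t) * indicator {a..a + real n} t)" .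
  qed (auto intro!: SUP_least simp: indicator_def)
  then have "(\<integral>\<^sup>+t\<in>{a..}. ennreal (f t) \<partial>lborel)
      = (\<integral>\<^sup>+t. (SUP n. ennreal (f t) * indicator {a..a + real n} t) \<partial>lborel)" by simp
  also have "\<dots> = (SUP n. \<integral>\<^sup>+t. ennreal (f t) * indicator {a..a + real n} t \<partial>lborel)"
    using f by (intro nn_integral_monotone_convergence_SUP)
      (auto intro!: incseq_SucI le_funI simp: indicator_def)
  also have "\<dots> \<le> ennreal (F a)"
  proof (rule SUP_least)
    fix n
    have "(\<integral>\<^sup>+t. ennreal (f t) * indicator {a..a + real n} t \<partial>lborel)
        = ennreal (- F (a + real n) - (- F a))"
    proof (rule nn_integral_FTC_Icc)
      show "DERIV (\<lambda>t. - F t) x :> f x" for x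
        using DERIV_minus[OF F[of x]] by simp
    qed (use f in auto)
    also have "\<dots> \<le> ennreal (F a)" using F0 by (intro ennreal_leI) (simp add: add.commute)
    finally show "(\<integral>\<^sup>+t. ennreal (f t) * indicator {a..a + real n} t \<partial>lborel) \<le> ennreal (F a)" .
  qed
  finally show ?thesis .
qed

subsection \<open>Fourier coefficients of a truncated shift\<close>

text \<open>These are the values \<open>fourier_basis n 0\<close>. Summing Fourier coefficients
  against them therefore evaluates a partial Fourier sum at 0.\<close>

definition fourier_v :: "nat \<Rightarrow> real" where
  "fourier_v n = (if n = 0 then 1 else if odd n then sqrt 2 else 0)"

text \<open>The matrix of d/dt in the Fourier basis: the derivative of
  \<open>fourier_basis n\<close> is the sum over \<open>k\<close> of \<open>fourier_rot n k\<close>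
  times \<open>fourier_basis k\<close>.\<close>

definition fourier_rot :: "nat \<Rightarrow> nat \<Rightarrow> real" where
  "fourier_rot n k =
     (if n = k + 1 \<and> odd k then 2 * pi * ((real k + 1) / 2)
      else if k = n + 1 \<and> odd n then - 2 * pi * ((real n + 1) / 2)
      else 0)"

text \<open>Each nonzero entry of \<open>fourier_rot\<close> has an even positive index, where
  \<open>fourier_v\<close> vanishes. The two parts thus have disjoint supports, and the cases of
  \<open>fourier_A\<close> list them side by side.\<close>

lemma fourier_A_index:
  assumes "n < N" "k < N"
  shows "fourier_A N $$ (n, k) = fourier_rot n k - 2 * fourier_v n * fourier_v k"
  using assms by (auto simp: fourier_A_def fourier_rot_def fourier_v_def)

lemma fourier_B_index: "n < N \<Longrightarrow> vec_index (fourier_B N) n = 2 * fourier_v n"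
  by (simp add: fourier_B_def fourier_v_def)

lemma fourier_rot_skew: "fourier_rot i j = - fourier_rot j i"
  by (auto simp: fourier_rot_def)

lemma fourier_index_cases:
  fixes n :: nat
  obtains "n = 0" | m where "n = 2 * m + 1" | m where "n = 2 * m + 2"
proof (cases "n = 0 \<or> odd n")
  case True
  then show ?thesis using that by (auto elim: oddE)
next
  case False
  then obtain k where "n = 2 * k" "k \<noteq> 0" by (auto elim: evenE)
  then show ?thesis using that(3)[of "k - 1"] by simp
qed

lemma fourier_basis_simps:
  "fourier_basis 0 t = 1"
  "fourier_basis (2 * m + 1) t = sqrt 2 * cos (2 * pi * real (m + 1) * t)"
  "fourier_basis (2 * m + 2) t = sqrt 2 * sin (2 * pi * real (m + 1) * t)"
  by (simp_all add: fourier_basis_def fourier_c_def fourier_s_def)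

lemma fourier_v_simps:
  "fourier_v 0 = 1" "fourier_v (2 * m + 1) = sqrt 2" "fourier_v (2 * m + 2) = 0"
  by (simp_all add: fourier_v_def)

text \<open>A row has at most one nonzero entry, coupling the cosine and the sine of one frequency.
  The odd dimension \<open>2 * M + 1\<close> separates no such pair, so truncation drops no entry of
  these rows.\<close>

lemma sum_fourier_rot:
  "(\<Sum>i<2 * M + 1. fourier_rot 0 i * f i) = 0"
  "m < M \<Longrightarrow> (\<Sum>i<2 * M + 1. fourier_rot (2 * m + 1) i * f i) = - (2 * pi * real (m + 1)) * f (2 * m + 2)"
  "m < M \<Longrightarrow> (\<Sum>i<2 * M + 1. fourier_rot (2 * m + 2) i * f i) = 2 * pi * real (m + 1) * f (2 * m + 1)"
proof -
  have "fourier_rot 0 i = 0" for i by (simp add: fourier_rot_def)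
  then show "(\<Sum>i<2 * M + 1. fourier_rot 0 i * f i) = 0" by simp
  assume m: "m < M"
  have "fourier_rot (2 * m + 1) i * f i
      = (if i = 2 * m + 2 then - (2 * pi * real (m + 1)) * f i else 0)" for i
    by (auto simp: fourier_rot_def)
  then have "(\<Sum>i<2 * M + 1. fourier_rot (2 * m + 1) i * f i)
      = (\<Sum>i<2 * M + 1. if i = 2 * m + 2 then - (2 * pi * real (m + 1)) * f i else 0)" by simp
  also have "\<dots> = - (2 * pi * real (m + 1)) * f (2 * m + 2)"
    using m by (subst sum.delta) auto
  finally show "(\<Sum>i<2 * M + 1. fourier_rot (2 * m + 1) i * f i)
      = - (2 * pi * real (m + 1)) * f (2 * m + 2)" .
  have "fourier_rot (2 * m + 2) i * f i
      = (if i = 2 * m + 1 then 2 * pi * real (m + 1) * f i else 0)" for i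
    by (auto simp: fourier_rot_def)
  then have "(\<Sum>i<2 * M + 1. fourier_rot (2 * m + 2) i * f i)
      = (\<Sum>i<2 * M + 1. if i = 2 * m + 1 then 2 * pi * real (m + 1) * f i else 0)" by simp
  also have "\<dots> = 2 * pi * real (m + 1) * f (2 * m + 1)"
    using m by (subst sum.delta) auto
  finally show "(\<Sum>i<2 * M + 1. fourier_rot (2 * m + 2) i * f i)
      = 2 * pi * real (m + 1) * f (2 * m + 1)" .
qed

section \<open>Orthonormality of the trigonometric system on [0,1]\<close>

lemma has_integral_cos_2pi_int:
  "((\<lambda>t. cos (2 * pi * of_int k * t)) has_integral (if k = 0 then 1 else 0)) {0..1::real}"
proof (cases "k = 0")
  case True
  then show ?thesis using has_integral_const_real[of "1::real" 0 1] by simp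
next
  case False
  define F where "F t = sin (2 * pi * of_int k * t) / (2 * pi * of_int k)" for t :: real
  have "((\<lambda>t. cos (2 * pi * of_int k * t)) has_integral (F 1 - F 0)) {0..1}"
    by (rule fundamental_theorem_of_calculus)
      (auto simp: F_def False has_real_derivative_iff_has_vector_derivative[symmetric]
        intro!: derivative_eq_intros)
  moreover have "F 1 - F 0 = 0"
    using sin_int_2pin[of k] by (simp add: F_def mult_ac)
  ultimately show ?thesis using False by simp
qed

lemma has_integral_sin_2pi_int:
  "((\<lambda>t. sin (2 * pi * of_int k * t)) has_integral 0) {0..1::real}"
proof (cases "k = 0")
  case False
  define F where "F t = - cos (2 * pi * of_int k * t) / (2 * pi * of_int k)" for t :: real
  have "((\<lambda>t. sin (2 * pi * of_int k * t)) has_integral (F 1 - F 0)) {0..1}"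
    by (rule fundamental_theorem_of_calculus)
      (auto simp: F_def False has_real_derivative_iff_has_vector_derivative[symmetric]
        intro!: derivative_eq_intros)
  moreover have "F 1 - F 0 = 0"
    using cos_int_2pin[of k] by (simp add: F_def mult_ac)
  ultimately show ?thesis by simp
qed simp

text \<open>Product-to-sum formulas. Integer frequencies make \<open>j - k\<close> available without
  case distinction; the two summands record whether \<open>j - k\<close> or \<open>j + k\<close>
  vanishes.\<close>

lemma has_integral_trig_products:
  fixes j k :: int
  shows "((\<lambda>t. cos (2 * pi * of_int j * t) * cos (2 * pi * of_int k * t)) has_integral
           ((if j = k then 1 else 0) + (if j = - k then 1 else 0)) / 2) {0..1::real}" (is ?cc)
    and "((\<lambda>t. sin (2 * pi * of_int j * t) * sin (2 * pi * of_int k * t)) has_integral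
           ((if j = k then 1 else 0) - (if j = - k then 1 else 0)) / 2) {0..1::real}" (is ?ss)
    and "((\<lambda>t. sin (2 * pi * of_int j * t) * cos (2 * pi * of_int k * t)) has_integral 0) {0..1::real}"
      (is ?sc)
proof -
  have split: "2 * pi * of_int j * t - 2 * pi * of_int k * t = 2 * pi * of_int (j - k) * t"
      "2 * pi * of_int j * t + 2 * pi * of_int k * t = 2 * pi * of_int (j + k) * t" for t :: real
    by (simp_all add: algebra_simps)
  show ?cc
    using has_integral_divide[OF has_integral_add
        [OF has_integral_cos_2pi_int[of "j - k"] has_integral_cos_2pi_int[of "j + k"]], of 2]
    unfolding cos_times_cos split by (simp add: eq_neg_iff_add_eq_0)
  show ?ss
    using has_integral_divide[OF has_integral_diff
        [OF has_integral_cos_2pi_int[of "j - k"] has_integral_cos_2pi_int[of "j + k"]], of 2]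
    unfolding sin_times_sin split by (simp add: eq_neg_iff_add_eq_0)
  show ?sc
    using has_integral_divide[OF has_integral_add
        [OF has_integral_sin_2pi_int[of "j + k"] has_integral_sin_2pi_int[of "j - k"]], of 2]
    unfolding sin_times_cos split by simp
qed

lemma fourier_basis_orthonormal:
  "((\<lambda>t. fourier_basis n t * fourier_basis m t) has_integral (if n = m then 1 else 0)) {0..1}"
proof -
  have c: "((\<lambda>t. fourier_basis (2 * a + 1) t) has_integral 0) {0..1}"
    and s: "((\<lambda>t. fourier_basis (2 * a + 2) t) has_integral 0) {0..1}" for a
    using has_integral_mult_right[OF has_integral_cos_2pi_int[of "int (a + 1)"], of "sqrt 2"]
      has_integral_mult_right[OF has_integral_sin_2pi_int[of "int (a + 1)"], of "sqrt 2"]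
    unfolding fourier_basis_simps by simp_all
  have sq: "sqrt 2 * y * (sqrt 2 * z) = 2 * (y * z)" for y z :: real
    using real_sqrt_mult_self[of 2] by (simp add: algebra_simps)
  have cc: "((\<lambda>t. fourier_basis (2 * a + 1) t * fourier_basis (2 * b + 1) t)
          has_integral (if a = b then 1 else 0)) {0..1}"
    and ss: "((\<lambda>t. fourier_basis (2 * a + 2) t * fourier_basis (2 * b + 2) t)
          has_integral (if a = b then 1 else 0)) {0..1}"
    and sc: "((\<lambda>t. fourier_basis (2 * a + 2) t * fourier_basis (2 * b + 1) t)
          has_integral 0) {0..1}" for a b
    using has_integral_mult_right[OF
        has_integral_trig_products(1)[of "int (a + 1)" "int (b + 1)"], of 2]
      has_integral_mult_right[OF
        has_integral_trig_products(2)[of "int (a + 1)" "int (b + 1)"], of 2]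
      has_integral_mult_right[OF
        has_integral_trig_products(3)[of "int (a + 1)" "int (b + 1)"], of 2]
    unfolding fourier_basis_simps sq by simp_all
  have one: "((\<lambda>t. fourier_basis 0 t) has_integral 1) {0..1}"
    using has_integral_const_real[of "1::real" 0 1] by (simp add: fourier_basis_simps)
  have cs: "((\<lambda>t. fourier_basis (2 * a + 1) t * fourier_basis (2 * b + 2) t)
          has_integral 0) {0..1}" for a b
    using sc[of b a] by (simp only: mult.commute)
  \<comment> \<open>A cosine index is never a sine index; this decides \<open>n = m\<close> in the
    mixed cases.\<close>
  have ne: "2 * a + 1 \<noteq> 2 * b + 2" for a b :: nat by presburger
  show ?thesis
    by (cases rule: fourier_index_cases[of n]; cases rule: fourier_index_cases[of m]; hypsubst)
      (use one c s cc ss sc cs ne ne[symmetric] in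
        \<open>simp_all only: fourier_basis_simps(1) mult_1_left mult_1_right, auto\<close>)
qed

section \<open>Evolution of the Fourier coefficients of the truncated shift\<close>

lemma integral_conv_trig_has_derivative:
  fixes g :: "real \<Rightarrow> real" and x :: real
  assumes g: "continuous_on {0..1} g" and t: "t \<in> {0..1}"
  shows "((\<lambda>t. integral {t..1} (\<lambda>r. g r * cos (x * (r - t)))) has_real_derivative
           x * integral {t..1} (\<lambda>r. g r * sin (x * (r - t))) - g t) (at t within {0..1})" (is ?C)
    and "((\<lambda>t. integral {t..1} (\<lambda>r. g r * sin (x * (r - t)))) has_real_derivative
           - x * integral {t..1} (\<lambda>r. g r * cos (x * (r - t)))) (at t within {0..1})" (is ?S)
proof -
  \<comment> \<open>The parameter \<open>t\<close> occurs both in the limit of integration and in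
    the integrand. The addition formulas pull it out of the integrand, and the fundamental theorem
    of calculus handles the limit.\<close>
  define C where "C t = integral {t..1} (\<lambda>r. g r * cos (x * r))" for t
  define S where "S t = integral {t..1} (\<lambda>r. g r * sin (x * r))" for t
  have int: "(\<lambda>r. g r * cos (x * r)) integrable_on {t..1}"
      "(\<lambda>r. g r * sin (x * r)) integrable_on {t..1}" if "t \<in> {0..1}" for t
    using that by (auto intro!: integrable_continuous_real continuous_intros
        continuous_on_subset[OF g])
  have eq_c: "integral {t..1} (\<lambda>r. g r * cos (x * (r - t))) = cos (x * t) * C t + sin (x * t) * S t"
    and eq_s: "integral {t..1} (\<lambda>r. g r * sin (x * (r - t))) = cos (x * t) * S t - sin (x * t) * C t"
    if "t \<in> {0..1}" for t
  proof -
    have "integral {t..1} (\<lambda>r. g r * cos (x * (r - t)))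
        = integral {t..1} (\<lambda>r. cos (x * t) * (g r * cos (x * r)) + sin (x * t) * (g r * sin (x * r)))"
      by (intro integral_cong) (simp add: algebra_simps cos_diff)
    also have "\<dots> = cos (x * t) * C t + sin (x * t) * S t"
      unfolding C_def S_def using int[OF that] by (subst integral_add) (auto intro: integrable_on_mult_right)
    finally show "integral {t..1} (\<lambda>r. g r * cos (x * (r - t)))
        = cos (x * t) * C t + sin (x * t) * S t" .
    have "integral {t..1} (\<lambda>r. g r * sin (x * (r - t)))
        = integral {t..1} (\<lambda>r. cos (x * t) * (g r * sin (x * r)) - sin (x * t) * (g r * cos (x * r)))"
      by (intro integral_cong) (simp add: algebra_simps sin_diff)
    also have "\<dots> = cos (x * t) * S t - sin (x * t) * C t"
      unfolding C_def S_def using int[OF that] by (subst integral_diff) (auto intro: integrable_on_mult_right)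
    finally show "integral {t..1} (\<lambda>r. g r * sin (x * (r - t)))
        = cos (x * t) * S t - sin (x * t) * C t" .
  qed
  have dC: "(C has_real_derivative - (g t * cos (x * t))) (at t within {0..1})"
    and dS: "(S has_real_derivative - (g t * sin (x * t))) (at t within {0..1})"
    unfolding C_def S_def
    by (intro integral_has_real_derivative' t continuous_intros g)+
  \<comment> \<open>The boundary terms from the lower limit combine to \<open>- g t\<close> in the
    cosine case by this identity; in the sine case they cancel.\<close>
  have g1: "g t * cos (x * t) * cos (x * t) + g t * sin (x * t) * sin (x * t) = g t"
    using sin_cos_squared_add3[of "x * t"] by (metis add.commute distrib_left mult.assoc mult.right_neutral)
  have "((\<lambda>t. cos (x * t) * C t + sin (x * t) * S t) has_real_derivative
      x * (cos (x * t) * S t - sin (x * t) * C t) - g t) (at t within {0..1})"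
    by (rule derivative_eq_intros dC dS refl)+ (use g1 in \<open>simp add: algebra_simps\<close>)
  then show ?C
    unfolding eq_s[OF t]
    by (rule has_field_derivative_transform_within[where d = 1]) (use t in \<open>auto simp: eq_c\<close>)
  have "((\<lambda>t. cos (x * t) * S t - sin (x * t) * C t) has_real_derivative
      - x * (cos (x * t) * C t + sin (x * t) * S t)) (at t within {0..1})"
    by (rule derivative_eq_intros dC dS refl)+ (simp add: algebra_simps)
  then show ?S
    unfolding eq_c[OF t]
    by (rule has_field_derivative_transform_within[where d = 1]) (use t in \<open>auto simp: eq_s\<close>)
qed

text \<open>The Fourier coefficient with index \<open>j\<close> of the function x \<mapsto> g(x + t)
  cut off to [0, 1 - t], written in the variable r = x + t.\<close>

definition fourier_conv :: "(real \<Rightarrow> real) \<Rightarrow> nat \<Rightarrow> real \<Rightarrow> real" where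
  "fourier_conv g j t = integral {t..1} (\<lambda>r. g r * fourier_basis j (r - t))"

text \<open>The moving lower limit contributes \<open>- g t * fourier_basis j 0\<close>, and
  differentiating the basis function in \<open>t\<close> gives minus row \<open>j\<close> of
  \<open>fourier_rot\<close>. The outcome is the linear system of a row of the matrix exponential,
  with \<open>g\<close> in place of the kernel.\<close>

lemma fourier_conv_has_derivative:
  assumes g: "continuous_on {0..1} g" and t: "t \<in> {0..1}" and j: "j < 2 * M + 1"
  shows "(fourier_conv g j has_real_derivative
           - (\<Sum>i<2 * M + 1. fourier_rot j i * fourier_conv g i t) - g t * fourier_v j)
         (at t within {0..1})"
proof -
  define x where "x m = 2 * pi * real (m + 1)" for m
  define C where "C m t = integral {t..1} (\<lambda>r. g r * cos (x m * (r - t)))" for m t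
  define S where "S m t = integral {t..1} (\<lambda>r. g r * sin (x m * (r - t)))" for m t
  have c: "fourier_conv g (2 * m + 1) = (\<lambda>t. sqrt 2 * C m t)"
    and s: "fourier_conv g (2 * m + 2) = (\<lambda>t. sqrt 2 * S m t)" for m
    unfolding fourier_conv_def fourier_basis_simps x_def[symmetric] C_def S_def
    by (simp_all add: mult.left_commute[of _ "sqrt 2"])
  have dC: "(C m has_real_derivative x m * S m t - g t) (at t within {0..1})"
    and dS: "(S m has_real_derivative - x m * C m t) (at t within {0..1})" for m
    unfolding C_def S_def by (rule integral_conv_trig_has_derivative[OF g t])+
  show ?thesis
  proof (cases rule: fourier_index_cases[of j])
    case 1
    have "fourier_conv g 0 = (\<lambda>t. integral {t..1} g)"
      by (simp add: fourier_conv_def fourier_basis_simps fun_eq_iff)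
    then show ?thesis
      using integral_has_real_derivative'[OF g t] unfolding 1 sum_fourier_rot fourier_v_simps by simp
  next
    case (2 m)
    then have "m < M" using j by simp
    show ?thesis unfolding 2 sum_fourier_rot(2)[OF \<open>m < M\<close>] fourier_v_simps c s
      by (rule derivative_eq_intros dC refl)+ (simp add: x_def algebra_simps)
  next
    case (3 m)
    then have "m < M" using j by simp
    show ?thesis unfolding 3 sum_fourier_rot(3)[OF \<open>m < M\<close>] fourier_v_simps c s
      by (rule derivative_eq_intros dS refl)+ (simp add: x_def algebra_simps)
  qed
qed

text \<open>Orthonormality makes the coefficients start at row \<open>n\<close> of the identity,
  exactly as row \<open>n\<close> of the matrix exponential does.\<close>

lemma fourier_conv_basis_0: "fourier_conv (fourier_basis n) j 0 = (if n = j then 1 else 0)"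
  unfolding fourier_conv_def using integral_unique[OF fourier_basis_orthonormal[of n j]] by simp

lemma fourier_conv_1 [simp]: "fourier_conv g j 1 = 0"
  by (simp add: fourier_conv_def)

subsection \<open>The sawtooth series\<close>

text \<open>The partial sum of the Fourier series of 1/2 - x on (0,1), minus 1/2 - x itself.\<close>

definition sawtooth :: "nat \<Rightarrow> real \<Rightarrow> real" where
  "sawtooth M x = x - 1 / 2 + (\<Sum>m<M. sin (2 * pi * real (m + 1) * x) / (pi * real (m + 1)))"

text \<open>The right-hand side is the Dirichlet kernel: sines drop out because
  \<open>fourier_v\<close> vanishes at their indices, and each cosine carries the factor
  \<open>sqrt 2\<close> twice.\<close>

lemma sum_fourier_v_basis:
  "(\<Sum>j<2 * M + 1. fourier_v j * fourier_basis j x) = 1 + (\<Sum>m<M. 2 * cos (2 * pi * real (m + 1) * x))"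
proof (induction M)
  case 0
  show ?case by (simp add: fourier_v_simps fourier_basis_simps)
next
  case (Suc M)
  have "{..<2 * Suc M + 1} = insert (2 * M + 1) (insert (2 * M + 2) {..<2 * M + 1})" by auto
  then show ?case
    using Suc fourier_v_simps(2,3)[of M] fourier_basis_simps(2,3)[of M x]
    by (simp add: mult_ac real_sqrt_mult_self[of 2, simplified])
qed

lemma sawtooth_has_derivative:
  "(sawtooth M has_real_derivative (\<Sum>j<2 * M + 1. fourier_v j * fourier_basis j x)) (at x)"
proof -
  have "((\<lambda>x. sin (2 * pi * real (m + 1) * x) / (pi * real (m + 1))) has_real_derivative
      2 * cos (2 * pi * real (m + 1) * x)) (at x)" for m
    by (auto intro!: derivative_eq_intros simp: divide_simps)
  then have "((\<lambda>x. x - 1 / 2 + (\<Sum>m<M. sin (2 * pi * real (m + 1) * x) / (pi * real (m + 1))))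
      has_real_derivative 1 - 0 + (\<Sum>m<M. 2 * cos (2 * pi * real (m + 1) * x))) (at x)"
    by (intro DERIV_add DERIV_diff DERIV_ident DERIV_const DERIV_sum)
  then show ?thesis by (simp only: sum_fourier_v_basis sawtooth_def[abs_def] diff_0_right)
qed

lemma continuous_on_fourier_basis [continuous_intros]:
  fixes f :: "real \<Rightarrow> real"
  assumes "continuous_on S f"
  shows "continuous_on S (\<lambda>x. fourier_basis n (f x))"
proof (cases rule: fourier_index_cases[of n])
  case 1
  show ?thesis unfolding 1 fourier_basis_simps by (rule continuous_on_const)
next
  case (2 m)
  show ?thesis unfolding 2 fourier_basis_simps by (intro continuous_intros assms)
next
  case (3 m)
  show ?thesis unfolding 3 fourier_basis_simps by (intro continuous_intros assms)
qed

lemma continuous_on_sawtooth [continuous_intros]: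
  fixes f :: "real \<Rightarrow> real"
  assumes "continuous_on S f"
  shows "continuous_on S (\<lambda>x. sawtooth M (f x))"
proof -
  have "continuous_on S (\<lambda>x. sin (2 * pi * real (m + 1) * f x) / (pi * real (m + 1)))" for m
    by (intro continuous_intros assms) auto
  then show ?thesis
    unfolding sawtooth_def
    by (intro continuous_on_add continuous_on_diff continuous_on_sum continuous_on_const assms)
qed

text \<open>This value, the same for all \<open>M\<close>, is the source of the term
  \<open>g t / 2\<close>: a Fourier series at a jump takes half of the one-sided limit when the
  other limit is 0.\<close>

lemma sawtooth_0: "sawtooth M 0 = - 1 / 2"
  by (simp add: sawtooth_def)

lemma sawtooth_reflect: "sawtooth M (1 - x) = - sawtooth M x"
proof -
  have "sin (2 * pi * real (m + 1) * (1 - x)) = - sin (2 * pi * real (m + 1) * x)" for m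
  proof -
    have "2 * pi * real (m + 1) * (1 - x) = 2 * real (m + 1) * pi - 2 * pi * real (m + 1) * x"
      by (simp add: algebra_simps)
    then show ?thesis
      using sin_2npi[of "m + 1"] cos_2npi[of "m + 1"] by (simp only: sin_diff)
  qed
  then show ?thesis by (simp add: sawtooth_def sum_negf)
qed

lemma has_integral_linear_sin:
  fixes k :: nat
  assumes "k > 0"
  shows "((\<lambda>x. (x - 1 / 2) * sin (2 * pi * real k * x)) has_integral - 1 / (2 * pi * real k)) {0..1}"
proof -
  define a where "a = 2 * pi * real k"
  have a: "a > 0" using assms by (simp add: a_def)
  \<comment> \<open>The antiderivative found by integrating by parts once.\<close>
  define F where "F x = - (x - 1 / 2) * cos (a * x) / a + sin (a * x) / a\<^sup>2" for x
  have "((\<lambda>x. (x - 1 / 2) * sin (a * x)) has_integral (F 1 - F 0)) {0..1}"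
    by (rule fundamental_theorem_of_calculus)
      (use a in \<open>auto simp: F_def has_real_derivative_iff_has_vector_derivative[symmetric]
        field_simps power2_eq_square intro!: derivative_eq_intros\<close>)
  moreover have "F 1 - F 0 = - 1 / a"
    using sin_2npi[of k] cos_2npi[of k] a by (simp add: F_def a_def mult_ac field_simps)
  ultimately show ?thesis by (simp add: a_def)
qed

lemma has_integral_sin_sin:
  fixes j k :: nat
  assumes "k > 0"
  shows "((\<lambda>x. sin (2 * pi * real j * x) * sin (2 * pi * real k * x)) has_integral
           (if j = k then 1 / 2 else 0)) {0..1}"
proof -
  \<comment> \<open>Natural frequencies with \<open>k > 0\<close> cannot be opposite, so only the
    diagonal term survives.\<close>
  have "(if int j = - int k then 1 else 0 :: real) = 0" using assms by auto
  then show ?thesis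
    using has_integral_trig_products(2)[of "int j" "int k"] by (simp split: if_splits)
qed

text \<open>Bessel's identity: starting from the squared norm 1/12 of x - 1/2, each new sine enters
  with its Fourier coefficient and lowers the squared norm by half the square of that
  coefficient.\<close>

lemma has_integral_sawtooth_squared:
  "((\<lambda>x. (sawtooth M x)\<^sup>2) has_integral
     (1 / 12 - (\<Sum>m<M. 1 / (real m + 1)\<^sup>2) / (2 * pi\<^sup>2))) {0..1}"
proof (induction M)
  case 0
  have "((\<lambda>x. (x - 1 / 2)\<^sup>2) has_integral ((1 - 1 / 2) ^ 3 / 3 - (0 - 1 / 2) ^ 3 / 3)) {0..1::real}"
    by (rule fundamental_theorem_of_calculus)
      (auto simp: has_real_derivative_iff_has_vector_derivative[symmetric] power2_eq_square
        intro!: derivative_eq_intros)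
  then show ?case by (simp add: sawtooth_def power3_eq_cube)
next
  case (Suc M)
  define s where "s m x = sin (2 * pi * real (m + 1) * x)" for m x
  define c where "c m = pi * real (m + 1)" for m
  have lin: "((\<lambda>x. (x - 1 / 2) * s M x) has_integral - 1 / (2 * c M)) {0..1}"
    using has_integral_linear_sin[of "M + 1"] by (simp add: s_def c_def mult_ac)
  have ss: "((\<lambda>x. s m x * s M x) has_integral (if m = M then 1 / 2 else 0)) {0..1}" for m
    using has_integral_sin_sin[of "M + 1" "m + 1"] by (simp add: s_def)
  \<comment> \<open>Earlier sines are orthogonal to the new one, so only the linear part of
    \<open>sawtooth M\<close> contributes to the cross term.\<close>
  have "((\<lambda>x. s m x * s M x / c m) has_integral 0) {0..1}" if "m < M" for m
    using has_integral_divide[OF ss[of m], of "c m"] that by simp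
  then have "((\<lambda>x. \<Sum>m<M. s m x * s M x / c m) has_integral (\<Sum>m<M. 0)) {0..1}"
    by (intro has_integral_sum) auto
  from has_integral_add[OF lin this]
  have cross: "((\<lambda>x. sawtooth M x * s M x) has_integral - 1 / (2 * c M)) {0..1}"
    by (simp add: sawtooth_def s_def c_def algebra_simps sum_distrib_left)
  have step: "sawtooth (Suc M) x = sawtooth M x + s M x / c M" for x
    by (simp add: sawtooth_def s_def c_def)
  have "((\<lambda>x. (sawtooth M x)\<^sup>2 + 2 / c M * (sawtooth M x * s M x) + 1 / (c M)\<^sup>2 * (s M x * s M x))
      has_integral (1 / 12 - (\<Sum>m<M. 1 / (real m + 1)\<^sup>2) / (2 * pi\<^sup>2))
        + 2 / c M * (- 1 / (2 * c M)) + 1 / (c M)\<^sup>2 * (1 / 2)) {0..1}"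
    using Suc cross ss[of M] by (intro has_integral_add has_integral_mult_right) simp_all
  also have "(\<lambda>x. (sawtooth M x)\<^sup>2 + 2 / c M * (sawtooth M x * s M x) + 1 / (c M)\<^sup>2 * (s M x * s M x))
      = (\<lambda>x. (sawtooth (Suc M) x)\<^sup>2)"
    by (simp add: step power2_eq_square algebra_simps)
  also have "(1 / 12 - (\<Sum>m<M. 1 / (real m + 1)\<^sup>2) / (2 * pi\<^sup>2))
        + 2 / c M * (- 1 / (2 * c M)) + 1 / (c M)\<^sup>2 * (1 / 2)
      = 1 / 12 - (\<Sum>m<Suc M. 1 / (real m + 1)\<^sup>2) / (2 * pi\<^sup>2)"
  proof -
    have "c M * c M = pi\<^sup>2 * (real M + 1)\<^sup>2"
      by (simp add: c_def power2_eq_square algebra_simps)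
    then have "2 / c M * (- 1 / (2 * c M)) + 1 / (c M)\<^sup>2 * (1 / 2)
        = - (1 / (real M + 1)\<^sup>2 / (2 * pi\<^sup>2))"
      by (simp add: power2_eq_square mult_ac)
    then show ?thesis by (simp add: add_divide_distrib)
  qed
  finally show ?case .
qed

text \<open>The Basel sum \<open>pi\<^sup>2 / 6\<close> divided by \<open>2 * pi\<^sup>2\<close> is
  exactly 1/12.\<close>

lemma sawtooth_L2_tendsto_0: "(\<lambda>M. integral {0..1} (\<lambda>x. (sawtooth M x)\<^sup>2)) \<longlonglongrightarrow> 0"
proof -
  have "(\<lambda>M. \<Sum>m<M. 1 / (real m + 1)\<^sup>2) \<longlonglongrightarrow> pi\<^sup>2 / 6"
    using inverse_squares_sums by (simp add: sums_def add.commute)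
  then have "(\<lambda>M. 1 / 12 - (\<Sum>m<M. 1 / (real m + 1)\<^sup>2) / (2 * pi\<^sup>2))
      \<longlonglongrightarrow> 1 / 12 - pi\<^sup>2 / 6 / (2 * pi\<^sup>2)"
    by (intro tendsto_intros) auto
  then show ?thesis
    by (simp add: integral_unique[OF has_integral_sawtooth_squared])
qed

section \<open>Partial Fourier sums evaluated at the jump\<close>

lemma integral_abs_squared_le:
  fixes f :: "real \<Rightarrow> real"
  assumes f: "continuous_on {0..1} f"
  shows "(integral {0..1} (\<lambda>x. \<bar>f x\<bar>))\<^sup>2 \<le> integral {0..1} (\<lambda>x. (f x)\<^sup>2)"
proof -
  define a where "a = integral {0..1} (\<lambda>x. \<bar>f x\<bar>)"
  have i1: "(\<lambda>x. \<bar>f x\<bar>) integrable_on {0..1}" and i2: "(\<lambda>x. (f x)\<^sup>2) integrable_on {0..1}"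
    by (auto intro!: integrable_continuous_real continuous_intros f)
  \<comment> \<open>The integrand is the square of \<open>\<bar>f x\<bar> - a\<close>; on an
    interval of length 1, nonnegativity of its integral is the claim.\<close>
  have "((\<lambda>x. (f x)\<^sup>2 - 2 * a * \<bar>f x\<bar> + a\<^sup>2) has_integral
      integral {0..1} (\<lambda>x. (f x)\<^sup>2) - 2 * a * a + a\<^sup>2) {0..1}"
    using has_integral_const_real[of "a\<^sup>2" 0 1] unfolding a_def
    by (intro has_integral_add has_integral_diff has_integral_mult_right
        integrable_integral i1 i2) simp_all
  moreover have "0 \<le> (f x)\<^sup>2 - 2 * a * \<bar>f x\<bar> + a\<^sup>2" for x
    using zero_le_power2[of "\<bar>f x\<bar> - a"] by (simp add: power2_diff algebra_simps)
  ultimately have "0 \<le> integral {0..1} (\<lambda>x. (f x)\<^sup>2) - 2 * a * a + a\<^sup>2"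
    by (rule has_integral_nonneg)
  then show ?thesis by (simp add: a_def power2_eq_square)
qed

text \<open>Integration by parts against \<open>sawtooth M (r - t)\<close>: the boundary term at r =
  t gives \<open>g t / 2\<close>, the one at r = 1 is a multiple of \<open>sawtooth M t\<close>, and
  the remaining integral is at most \<open>C\<close> times the L^1 norm of the sawtooth. The bound
  keeps \<open>sawtooth M t\<close> pointwise, to be integrated over \<open>t\<close> later.\<close>

lemma fourier_conv_trace_error:
  fixes g g' :: "real \<Rightarrow> real"
  assumes g: "\<And>r. (g has_real_derivative g' r) (at r)" and g': "continuous_on UNIV g'"
    and bd: "\<And>r. \<bar>g r\<bar> \<le> C" "\<And>r. \<bar>g' r\<bar> \<le> C" and t: "t \<in> {0..1}"
  shows "((\<Sum>j<2 * M + 1. fourier_v j * fourier_conv g j t) - g t / 2)\<^sup>2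
           \<le> 2 * C\<^sup>2 * ((sawtooth M t)\<^sup>2 + integral {0..1} (\<lambda>x. (sawtooth M x)\<^sup>2))"
proof -
  define D where "D x = (\<Sum>j<2 * M + 1. fourier_v j * fourier_basis j x)" for x
  define a where "a = integral {0..1} (\<lambda>x. \<bar>sawtooth M x\<bar>)"
  have C: "C \<ge> 0" using bd(1)[of 0] by simp
  have cg: "continuous_on UNIV g"
    using g DERIV_isCont continuous_at_imp_continuous_on by blast
  have conv: "(\<Sum>j<2 * M + 1. fourier_v j * fourier_conv g j t) = integral {t..1} (\<lambda>r. g r * D (r - t))"
  proof -
    have "(\<Sum>j<2 * M + 1. fourier_v j * fourier_conv g j t)
        = integral {t..1} (\<lambda>r. \<Sum>j<2 * M + 1. fourier_v j * (g r * fourier_basis j (r - t)))"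
      unfolding fourier_conv_def
      by (subst integral_sum)
        (auto intro!: integrable_continuous_real continuous_intros continuous_on_subset[OF cg])
    then show ?thesis by (simp only: D_def sum_distrib_left mult.left_commute)
  qed
  have "((\<lambda>r. g' r * sawtooth M (r - t) + g r * D (r - t)) has_integral
      (g 1 * sawtooth M (1 - t) - g t * sawtooth M (t - t))) {t..1}"
  proof (rule fundamental_theorem_of_calculus)
    fix r
    have "((\<lambda>r. sawtooth M (r - t)) has_real_derivative D (r - t) * 1) (at r)"
      unfolding D_def
      by (rule DERIV_chain'[OF _ sawtooth_has_derivative]) (auto intro!: derivative_eq_intros)
    then have "((\<lambda>r. g r * sawtooth M (r - t)) has_real_derivative
        g' r * sawtooth M (r - t) + g r * D (r - t)) (at r)"
      by (auto intro!: derivative_eq_intros g)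
    then show "((\<lambda>r. g r * sawtooth M (r - t)) has_vector_derivative
        g' r * sawtooth M (r - t) + g r * D (r - t)) (at r within {t..1})"
      by (simp add: has_real_derivative_iff_has_vector_derivative has_vector_derivative_at_within)
  qed (use t in auto)
  moreover have g's: "(\<lambda>r. g' r * sawtooth M (r - t)) integrable_on {t..1}"
    by (auto intro!: integrable_continuous_real continuous_intros continuous_on_subset[OF g'])
  ultimately have "((\<lambda>r. g' r * sawtooth M (r - t) + g r * D (r - t) - g' r * sawtooth M (r - t))
      has_integral (g 1 * sawtooth M (1 - t) - g t * sawtooth M (t - t)
        - integral {t..1} (\<lambda>r. g' r * sawtooth M (r - t)))) {t..1}"
    by (intro has_integral_diff integrable_integral)
  then have "integral {t..1} (\<lambda>r. g r * D (r - t)) = g 1 * sawtooth M (1 - t) - g t * sawtooth M 0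
      - integral {t..1} (\<lambda>r. g' r * sawtooth M (r - t))"
    by (simp add: integral_unique)
  then have eq: "(\<Sum>j<2 * M + 1. fourier_v j * fourier_conv g j t) - g t / 2
      = - (g 1 * sawtooth M t) - integral {t..1} (\<lambda>r. g' r * sawtooth M (r - t))"
    unfolding conv by (simp add: sawtooth_0 sawtooth_reflect)
  have "\<bar>integral {t..1} (\<lambda>r. g' r * sawtooth M (r - t))\<bar>
      \<le> integral {t..1} (\<lambda>r. C * \<bar>sawtooth M (r - t)\<bar>)"
    unfolding real_norm_def[symmetric]
  proof (rule integral_norm_bound_integral[OF g's])
    show "norm (g' r * sawtooth M (r - t)) \<le> C * norm (sawtooth M (r - t))" for r
      using mult_right_mono[OF bd(2)[of r], of "\<bar>sawtooth M (r - t)\<bar>"] by (simp add: abs_mult)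
  qed (auto intro!: integrable_continuous_real continuous_intros)
  also have "\<dots> = C * integral {t..1} (\<lambda>r. \<bar>sawtooth M (r - t)\<bar>)" by simp
  also have "integral {t..1} (\<lambda>r. \<bar>sawtooth M (r - t)\<bar>) = integral {0..1 - t} (\<lambda>x. \<bar>sawtooth M x\<bar>)"
    using integral_shift_Icc_real[of t 1 "\<lambda>x. \<bar>sawtooth M x\<bar>" "- t"] by (simp add: o_def)
  also have "C * integral {0..1 - t} (\<lambda>x. \<bar>sawtooth M x\<bar>) \<le> C * a"
    unfolding a_def using t C
    by (intro mult_left_mono integral_subset_le)
      (auto intro!: integrable_continuous_real continuous_intros)
  finally have I: "\<bar>integral {t..1} (\<lambda>r. g' r * sawtooth M (r - t))\<bar> \<le> C * a" .
  have "\<bar>g 1 * sawtooth M t\<bar> \<le> C * \<bar>sawtooth M t\<bar>"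
    using mult_right_mono[OF bd(1)[of 1], of "\<bar>sawtooth M t\<bar>"] by (simp add: abs_mult)
  with I have "\<bar>(\<Sum>j<2 * M + 1. fourier_v j * fourier_conv g j t) - g t / 2\<bar>
      \<le> C * (\<bar>sawtooth M t\<bar> + a)"
    unfolding eq by (simp add: algebra_simps)
  then have "((\<Sum>j<2 * M + 1. fourier_v j * fourier_conv g j t) - g t / 2)\<^sup>2
      \<le> (C * (\<bar>sawtooth M t\<bar> + a))\<^sup>2"
    by (rule abs_le_square_iff[THEN iffD1, OF order_trans]) simp
  \<comment> \<open>The square of a sum is at most twice the sum of the squares.\<close>
  also have "\<dots> \<le> C\<^sup>2 * (2 * (sawtooth M t)\<^sup>2 + 2 * a\<^sup>2)"
    using zero_le_power2[of "\<bar>sawtooth M t\<bar> - a"]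
    by (auto simp: power_mult_distrib power2_sum power2_diff intro!: mult_left_mono)
  also have "\<dots> \<le> C\<^sup>2 * (2 * (sawtooth M t)\<^sup>2 + 2 * integral {0..1} (\<lambda>x. (sawtooth M x)\<^sup>2))"
    unfolding a_def
    by (intro mult_left_mono add_left_mono integral_abs_squared_le continuous_intros) auto
  finally show ?thesis by (simp add: algebra_simps)
qed

subsection \<open>Convergence of the kernels\<close>

text \<open>The energy \<open>W 1\<close> left at time 1 links the two halves: it bounds the kernel
  on [1, \<infinity>), and as the final energy of the difference it enters the estimate on [0,1]
  with the opposite sign.\<close>

lemma fourier_kernel_L2_error:
  fixes g' :: "real \<Rightarrow> real"
  assumes n: "n < 2 * M + 1"
    and g: "\<And>r. (fourier_basis n has_real_derivative g' r) (at r)" and g': "continuous_on UNIV g'"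
    and bd: "\<And>r. \<bar>fourier_basis n r\<bar> \<le> C" "\<And>r. \<bar>g' r\<bar> \<le> C"
  shows "(\<integral>\<^sup>+t\<in>{0..}. ennreal ((ssm_kernel (fourier_A (2 * M + 1)) (fourier_B (2 * M + 1)) n t
             - fourier_basis n t * indicator {0..1} t)\<^sup>2) \<partial>lborel)
           \<le> ennreal (16 * C\<^sup>2 * integral {0..1} (\<lambda>x. (sawtooth M x)\<^sup>2))"
proof -
  define N where "N = 2 * M + 1"
  define p where "p = fourier_basis n"
  define v where "v = fourier_v"
  define R where "R = fourier_rot"
  define A where "A = fourier_A N"
  define \<delta> where "\<delta> = integral {0..1} (\<lambda>x. (sawtooth M x)\<^sup>2)"
  have A: "A \<in> carrier_mat N N" by (simp add: A_def fourier_A_def)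
  have nN: "n < N" using n by (simp add: N_def)
  define w where "w j t = mat_exp (t \<cdot>\<^sub>m A) $$ (n, j)" for j t
  define K where "K = ssm_kernel A (fourier_B N) n"
  have K: "K t = 2 * (\<Sum>j<N. v j * w j t)" for t
  proof -
    have "K t = (\<Sum>j<N. w j t * vec_index (fourier_B N) j)"
      unfolding K_def w_def by (rule ssm_kernel_eq[OF A _ nN]) (simp add: fourier_B_def)
    then show ?thesis
      by (simp add: fourier_B_index v_def sum_distrib_left mult_ac)
  qed
  have dw: "(w j has_real_derivative - (\<Sum>i<N. R j i * w i t) - K t * v j) (at t)"
    if j: "j < N" for j t
  proof -
    have "(w j has_real_derivative (\<Sum>l<N. w l t * A $$ (l, j))) (at t)"
      unfolding w_def by (rule mat_exp_smult_has_derivative[OF A nN j])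
    also have "(\<Sum>l<N. w l t * A $$ (l, j)) = (\<Sum>l<N. - (R j l * w l t) - 2 * (v l * w l t) * v j)"
    \<comment> \<open>Skewness turns column \<open>j\<close> of the rotation into minus its row
      \<open>j\<close>; the rank-one part sums to the kernel through \<open>K\<close>.\<close>
    proof (intro sum.cong refl)
      fix l assume "l \<in> {..<N}"
      then show "w l t * A $$ (l, j) = - (R j l * w l t) - 2 * (v l * w l t) * v j"
        using j unfolding A_def R_def v_def
        by (simp add: fourier_A_index fourier_rot_skew[of l j]) (simp add: algebra_simps)
    qed
    also have "\<dots> = - (\<Sum>i<N. R j i * w i t) - K t * v j"
      by (simp add: K sum_subtractf sum_negf sum_distrib_left sum_distrib_right)
    finally show ?thesis .
  qed
  have skew: "R i j = - R j i" for i j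
    unfolding R_def by (rule fourier_rot_skew)
  define W where "W t = (\<Sum>j<N. (w j t)\<^sup>2)" for t
  have dW: "(W has_real_derivative - (K t)\<^sup>2) (at t)" for t
    using skew_energy_has_derivative[of "{..<N}" R w t "K t" v UNIV, OF skew dw]
    unfolding W_def by (simp add: K power2_eq_square mult_ac)
  have wc: "continuous_on S (w j)" if "j < N" for j S
    using dw[OF that] by (meson DERIV_isCont continuous_at_imp_continuous_on)
  have Kc: "continuous_on S K" for S
    unfolding K by (intro continuous_intros wc) auto
  have pc: "continuous_on S p" for S
    unfolding p_def by (intro continuous_intros)
  have tail: "(\<integral>\<^sup>+t\<in>{1..}. ennreal ((K t)\<^sup>2) \<partial>lborel) \<le> ennreal (W 1)"
    by (rule nn_integral_tail_le[OF dW])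
      (auto simp: W_def intro!: sum_nonneg borel_measurable_continuous_onI continuous_on_power Kc)
  define q where "q = fourier_conv p"
  define S where "S t = (\<Sum>j<N. v j * q j t)" for t
  define E where "E t = (\<Sum>j<N. (w j t - q j t)\<^sup>2)" for t
  \<comment> \<open>The difference is forced by \<open>K t - p t\<close>, and its product with
    \<open>v\<close> is \<open>K t / 2 - S t\<close>.\<close>
  have dE: "(E has_real_derivative - 2 * (K t - p t) * (K t / 2 - S t)) (at t within {0..1})"
    if t: "t \<in> {0..1}" for t
  proof -
    have "((\<lambda>t. w j t - q j t) has_real_derivative
        - (\<Sum>i<N. R j i * (w i t - q i t)) - (K t - p t) * v j) (at t within {0..1})"
      if j: "j < N" for j
    proof -
      have "(q j has_real_derivative - (\<Sum>i<N. R j i * q i t) - p t * v j) (at t within {0..1})"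
        unfolding q_def R_def v_def N_def
        by (rule fourier_conv_has_derivative[OF pc t]) (use j N_def in simp)
      from DERIV_diff[OF has_field_derivative_at_within[OF dw[OF j]] this]
      show ?thesis by (simp add: algebra_simps sum_subtractf)
    qed
    then have "(E has_real_derivative - 2 * (K t - p t) * (\<Sum>j<N. v j * (w j t - q j t)))
        (at t within {0..1})"
      unfolding E_def by (intro skew_energy_has_derivative[of _ R] skew) auto
    also have "(\<Sum>j<N. v j * (w j t - q j t)) = K t / 2 - S t"
      by (simp add: K S_def sum_subtractf algebra_simps)
    finally show ?thesis .
  qed
  have E0: "E 0 = 0"
    unfolding E_def w_def q_def p_def
    by (simp add: mat_exp_smult_0[OF A nN] fourier_conv_basis_0)
  have E1: "E 1 = W 1" unfolding E_def W_def q_def by simp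
  have iE: "((\<lambda>t. - 2 * (K t - p t) * (K t / 2 - S t)) has_integral W 1) {0..1}"
    using fundamental_theorem_of_calculus[of 0 1 E] dE E0 E1
    by (simp add: has_real_derivative_iff_has_vector_derivative)
  have i\<delta>: "((\<lambda>t. 8 * C\<^sup>2 * ((sawtooth M t)\<^sup>2 + \<delta>)) has_integral 8 * C\<^sup>2 * (\<delta> + \<delta>)) {0..1}"
    using has_integral_const_real[of \<delta> 0 1] unfolding \<delta>_def
    by (intro has_integral_mult_right has_integral_add integrable_integral)
      (auto intro!: integrable_continuous_real continuous_intros)
  define h where "h t = (K t - p t)\<^sup>2" for t
  have ih: "(h has_integral integral {0..1} h) {0..1}"
    unfolding h_def
    by (intro integrable_integral integrable_continuous_real continuous_intros Kc pc)
  \<comment> \<open>The factor \<open>- 2\<close> is chosen so that the pointwise inequality below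
    completes a square; 8 is 4 times the 2 of the trace error bound.\<close>
  have "integral {0..1} h \<le> - 2 * W 1 + 8 * C\<^sup>2 * (\<delta> + \<delta>)"
  proof (rule has_integral_le[OF ih has_integral_add[OF has_integral_mult_right[OF iE, of "- 2"] i\<delta>]])
    fix t :: real assume t: "t \<in> {0..1}"
    have "(S t - p t / 2)\<^sup>2 \<le> 2 * C\<^sup>2 * ((sawtooth M t)\<^sup>2 + \<delta>)"
      unfolding S_def q_def p_def v_def N_def \<delta>_def
      by (rule fourier_conv_trace_error[OF g g' bd t])
    moreover have "h t \<le> - 2 * (- 2 * (K t - p t) * (K t / 2 - S t)) + 4 * (S t - p t / 2)\<^sup>2"
    proof -
      have "- 2 * (- 2 * (K t - p t) * (K t / 2 - S t)) + 4 * (S t - p t / 2)\<^sup>2 - h t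
          = (K t - 2 * S t)\<^sup>2"
        by (simp add: h_def power2_eq_square algebra_simps)
      then show ?thesis using zero_le_power2[of "K t - 2 * S t"] by linarith
    qed
    ultimately show "h t \<le> - 2 * (- 2 * (K t - p t) * (K t / 2 - S t))
        + 8 * C\<^sup>2 * ((sawtooth M t)\<^sup>2 + \<delta>)" by linarith
  qed
  moreover have W1: "W 1 \<ge> 0" unfolding W_def by (intro sum_nonneg) auto
  ultimately have hW: "integral {0..1} h + W 1 \<le> 16 * C\<^sup>2 * \<delta>" by (simp add: algebra_simps)
  have hm: "(\<lambda>t. ennreal (h t)) \<in> borel_measurable lborel"
    and Km: "(\<lambda>t. ennreal ((K t)\<^sup>2)) \<in> borel_measurable lborel"
    unfolding h_def
    by (auto intro!: measurable_compose[OF _ measurable_ennreal]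
      borel_measurable_continuous_onI continuous_intros Kc pc)
  \<comment> \<open>Both indicators on the right count t = 1, which an upper bound permits.\<close>
  have "(\<integral>\<^sup>+t\<in>{0..}. ennreal ((K t - p t * indicator {0..1} t)\<^sup>2) \<partial>lborel)
      \<le> (\<integral>\<^sup>+t. ennreal (h t) * indicator {0..1} t + ennreal ((K t)\<^sup>2) * indicator {1..} t \<partial>lborel)"
    by (intro nn_integral_mono) (auto simp: indicator_def h_def)
  also have "\<dots> = (\<integral>\<^sup>+t\<in>{0..1}. ennreal (h t) \<partial>lborel) + (\<integral>\<^sup>+t\<in>{1..}. ennreal ((K t)\<^sup>2) \<partial>lborel)"
    by (intro nn_integral_add borel_measurable_times_ennreal hm Km borel_measurable_indicator) auto
  also have "(\<integral>\<^sup>+t\<in>{0..1}. ennreal (h t) \<partial>lborel) = ennreal (integral {0..1} h)"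
  proof -
    have "(\<integral>\<^sup>+t. ennreal (indicator {0..1} t * h t) \<partial>lborel) = ennreal (integral {0..1} h)"
      by (rule nn_integral_has_integral_lebesgue[OF _ ih]) (simp add: h_def)
    moreover have "ennreal (indicator {0..1} t * h t) = ennreal (h t) * indicator {0..1} t" for t
      by (simp add: indicator_def)
    ultimately show ?thesis by simp
  qed
  also have "ennreal (integral {0..1} h) + (\<integral>\<^sup>+t\<in>{1..}. ennreal ((K t)\<^sup>2) \<partial>lborel)
      \<le> ennreal (integral {0..1} h) + ennreal (W 1)"
    by (intro add_left_mono tail)
  also have "\<dots> = ennreal (integral {0..1} h + W 1)"
    using W1 has_integral_nonneg[OF ih] by (subst ennreal_plus) (auto simp: h_def)
  also have "\<dots> \<le> ennreal (16 * C\<^sup>2 * \<delta>)" by (rule ennreal_leI[OF hW])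
  finally show ?thesis
    by (simp add: K_def A_def p_def \<delta>_def N_def)
qed

lemma fourier_basis_C1_bounded:
  obtains g' C where "\<And>r. (fourier_basis n has_real_derivative g' r) (at r)" "continuous_on UNIV g'"
    "\<And>r. \<bar>fourier_basis n r\<bar> \<le> C" "\<And>r. \<bar>g' r\<bar> \<le> C"
proof (cases rule: fourier_index_cases[of n])
  case 1
  show ?thesis
    by (rule that[of "\<lambda>_. 0" 1]) (auto simp: 1 fourier_basis_def)
next
  case (2 m)
  define a where "a = 2 * pi * real (m + 1)"
  \<comment> \<open>Since the angular frequency is at least 1, \<open>sqrt 2 * a\<close> bounds the
    function as well as its derivative.\<close>
  have a: "a \<ge> 1" using pi_ge_two by (simp add: a_def mult_ge1_I)
  have eq: "fourier_basis n = (\<lambda>t. sqrt 2 * cos (a * t))"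
    unfolding 2 fourier_basis_simps a_def ..
  show ?thesis
  proof (rule that[of "\<lambda>t. - sqrt 2 * a * sin (a * t)" "sqrt 2 * a"])
    show "(fourier_basis n has_real_derivative - sqrt 2 * a * sin (a * r)) (at r)" for r
      unfolding eq by (auto intro!: derivative_eq_intros)
    show "continuous_on UNIV (\<lambda>t. - sqrt 2 * a * sin (a * t))" by (intro continuous_intros)
    show "\<bar>fourier_basis n r\<bar> \<le> sqrt 2 * a" for r
      using order_trans[OF abs_cos_le_one a] by (simp add: eq abs_mult)
    show "\<bar>- sqrt 2 * a * sin (a * r)\<bar> \<le> sqrt 2 * a" for r
      using a abs_sin_le_one[of "a * r"] by (simp add: abs_mult mult_left_le)
  qed
next
  case (3 m)
  define a where "a = 2 * pi * real (m + 1)"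
  have a: "a \<ge> 1" using pi_ge_two by (simp add: a_def mult_ge1_I)
  have eq: "fourier_basis n = (\<lambda>t. sqrt 2 * sin (a * t))"
    unfolding 3 fourier_basis_simps a_def ..
  show ?thesis
  proof (rule that[of "\<lambda>t. sqrt 2 * a * cos (a * t)" "sqrt 2 * a"])
    show "(fourier_basis n has_real_derivative sqrt 2 * a * cos (a * r)) (at r)" for r
      unfolding eq by (auto intro!: derivative_eq_intros)
    show "continuous_on UNIV (\<lambda>t. sqrt 2 * a * cos (a * t))" by (intro continuous_intros)
    show "\<bar>fourier_basis n r\<bar> \<le> sqrt 2 * a" for r
      using order_trans[OF abs_sin_le_one a] by (simp add: eq abs_mult)
    show "\<bar>sqrt 2 * a * cos (a * r)\<bar> \<le> sqrt 2 * a" for r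
      using a abs_cos_le_one[of "a * r"] by (simp add: abs_mult mult_left_le)
  qed
qed

lemma fourier_kernel_tendsto:
  "(\<lambda>M. \<integral>\<^sup>+t\<in>{0..}. ennreal ((ssm_kernel (fourier_A (2 * M + 1)) (fourier_B (2 * M + 1)) n t
      - fourier_basis n t * indicator {0..1} t)\<^sup>2) \<partial>lborel) \<longlonglongrightarrow> 0"
proof -
  obtain g' C where C: "\<And>r. (fourier_basis n has_real_derivative g' r) (at r)"
    "continuous_on UNIV g'" "\<And>r. \<bar>fourier_basis n r\<bar> \<le> C" "\<And>r. \<bar>g' r\<bar> \<le> C"
    by (rule fourier_basis_C1_bounded[of n]) (rule that)
  have "(\<lambda>M. 16 * C\<^sup>2 * integral {0..1} (\<lambda>x. (sawtooth M x)\<^sup>2)) \<longlonglongrightarrow> 16 * C\<^sup>2 * 0"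
    by (intro tendsto_intros sawtooth_L2_tendsto_0)
  from tendsto_ennrealI[OF this]
  have lim: "(\<lambda>M. ennreal (16 * C\<^sup>2 * integral {0..1} (\<lambda>x. (sawtooth M x)\<^sup>2))) \<longlonglongrightarrow> 0" by simp
  show ?thesis
  proof (rule tendsto_sandwich[OF _ _ tendsto_const lim])
    show "\<forall>\<^sub>F M in sequentially.
      (\<integral>\<^sup>+t\<in>{0..}. ennreal ((ssm_kernel (fourier_A (2 * M + 1)) (fourier_B (2 * M + 1)) n t
        - fourier_basis n t * indicator {0..1} t)\<^sup>2) \<partial>lborel)
      \<le> ennreal (16 * C\<^sup>2 * integral {0..1} (\<lambda>x. (sawtooth M x)\<^sup>2))"
      \<comment> \<open>The estimate concerns kernels that exist, with \<open>n < 2 * M + 1\<close>;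
        this holds once \<open>M\<close> reaches \<open>n\<close>.\<close>
      using eventually_ge_at_top[of n]
      by eventually_elim (rule fourier_kernel_L2_error[OF _ C], simp)
  qed simp
qed

lemma fourier_tossm_kernels:
  "tossm_kernels UNIV (\<lambda>n t. fourier_basis n t * indicat_real {0..1} t) fourier_basis
     (indicat_real {0..1})"
  unfolding tossm_kernels_def
proof (intro conjI ballI allI impI)
  fix n m :: nat and t :: real
  define f where "f x = fourier_basis n x * fourier_basis m x * indicat_real {0..1} x" for x
  have f_eq: "f = (\<lambda>x. indicator {0..1} x *\<^sub>R (fourier_basis n x * fourier_basis m x))"
    by (simp add: f_def fun_eq_iff)
  have "set_integrable lborel {0..1} (\<lambda>x. fourier_basis n x * fourier_basis m x)"
    by (intro borel_integrable_atLeastAtMost' continuous_intros)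
  from this set_borel_integral_eq_integral(2)[OF this]
  have f: "integrable lborel f" "integral\<^sup>L lborel f = (if n = m then 1 else 0)"
    using integral_unique[OF fourier_basis_orthonormal[of n m]]
    by (simp_all add: f_eq set_integrable_def set_lebesgue_integral_def)
  \<comment> \<open>The support condition 0 \<le> t - s already forces s \<le> t, so the indicator
    of \<open>{..t}\<close> is absorbed and a reflected translate of \<open>f\<close> on the whole
    line remains.\<close>
  have shift: "indicator {..t} s *\<^sub>R (fourier_basis n (t - s) * fourier_basis m (t - s)
      * indicat_real {0..1} (t - s)) = f (t + - 1 * s)" for s
    by (auto simp: f_def indicator_def)
  show "set_integrable lborel {..t}
      (\<lambda>s. fourier_basis n (t - s) * fourier_basis m (t - s) * indicat_real {0..1} (t - s))"
    unfolding set_integrable_def shift using f(1) by (intro lborel_integrable_real_affine) auto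
  show "(LBINT s:{..t}. fourier_basis n (t - s) * fourier_basis m (t - s)
      * indicat_real {0..1} (t - s)) = (if n = m then 1 else 0)"
    unfolding set_lebesgue_integral_def shift f(2)[symmetric]
    using lborel_integral_real_affine[of "- 1" f t] by simp
qed auto

(* N = 2 M + 1 is the dimension at which 1, c_1, s_1, ..., c_M, s_M is a complete
   truncated Fourier basis.  For even N the last cosine lacks its sine. *)
theorem theorem6:
  shows "tossm_in_limit (\<lambda>M. fourier_A (2 * M + 1)) (\<lambda>M. fourier_B (2 * M + 1))
           fourier_basis (indicat_real {0..1})"
  unfolding tossm_in_limit_def
proof (intro conjI exI)
  show "\<forall>M. is_ssm (fourier_A (2 * M + 1)) (fourier_B (2 * M + 1))"
    by (simp add: is_ssm_def fourier_A_def fourier_B_def)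
  show "filterlim (\<lambda>M. dim_row (fourier_A (2 * M + 1))) at_top sequentially"
    by (intro filterlim_subseq strict_monoI) (simp add: fourier_A_def)
  \<comment> \<open>Unification with this statement fixes the limit kernels as the basis functions
    cut off to [0,1].\<close>
  show "\<forall>n. (\<lambda>M. \<integral>\<^sup>+t\<in>{0..}. ennreal ((ssm_kernel (fourier_A (2 * M + 1)) (fourier_B (2 * M + 1)) n t
      - fourier_basis n t * indicator {0..1} t)\<^sup>2) \<partial>lborel) \<longlonglongrightarrow> 0"
    using fourier_kernel_tendsto by blast
qed (rule fourier_tossm_kernels)

end
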